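(* A countably infinite graph $G$ is ME-homogeneous if and only if it is HE-homogeneous.
   Context: All graphs are undirected and loopless; $\sim$ denotes adjacency, and all subgraphs are induced. A homomorphism maps adjacent vertices to adjacent vertices; a monomorphism is an injective homomorphism. A countable graph $G$ is ME-homogeneous (resp. HE-homogeneous) if every monomorphism (resp. every homomorphism) between finite induced subgraphs of $G$ is the restriction of a surjective endomorphism $G\to G$. *)

theory Defs
  imports "HOL-Library.Countable_Set"
begin

definition graph :: "'a set \<Rightarrow> ('a \<Rightarrow> 'a \<Rightarrow> bool) \<Rightarrow> bool" where
  "graph V E \<longleftrightarrow> (\<forall>x y. E x y \<longrightarrow> x \<in> V \<and> y \<in> V) \<and> (\<forall>x y. E x y \<longrightarrow> E y x) \<and> (\<forall>x. \<not> E x x)"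

definition graph_hom :: "('a \<Rightarrow> 'a \<Rightarrow> bool) \<Rightarrow> 'a set \<Rightarrow> 'a set \<Rightarrow> ('a \<Rightarrow> 'a) \<Rightarrow> bool" where
  "graph_hom E A B f \<longleftrightarrow> f ` A \<subseteq> B \<and> (\<forall>x\<in>A. \<forall>y\<in>A. E x y \<longrightarrow> E (f x) (f y))"

definition graph_mono :: "('a \<Rightarrow> 'a \<Rightarrow> bool) \<Rightarrow> 'a set \<Rightarrow> 'a set \<Rightarrow> ('a \<Rightarrow> 'a) \<Rightarrow> bool" where
  "graph_mono E A B f \<longleftrightarrow> graph_hom E A B f \<and> inj_on f A"

definition extends_to_surj_endo :: "'a set \<Rightarrow> ('a \<Rightarrow> 'a \<Rightarrow> bool) \<Rightarrow> 'a set \<Rightarrow> ('a \<Rightarrow> 'a) \<Rightarrow> bool" where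
  "extends_to_surj_endo V E A f \<longleftrightarrow>
     (\<exists>g. graph_hom E V V g \<and> g ` V = V \<and> (\<forall>x\<in>A. g x = f x))"

definition ME_homogeneous :: "'a set \<Rightarrow> ('a \<Rightarrow> 'a \<Rightarrow> bool) \<Rightarrow> bool" where
  "ME_homogeneous V E \<longleftrightarrow>
     (\<forall>A B f. A \<subseteq> V \<and> B \<subseteq> V \<and> finite A \<and> finite B \<and> graph_mono E A B f
        \<longrightarrow> extends_to_surj_endo V E A f)"

definition HE_homogeneous :: "'a set \<Rightarrow> ('a \<Rightarrow> 'a \<Rightarrow> bool) \<Rightarrow> bool" where
  "HE_homogeneous V E \<longleftrightarrow>
     (\<forall>A B f. A \<subseteq> V \<and> B \<subseteq> V \<and> finite A \<and> finite B \<and> graph_hom E A B f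
        \<longrightarrow> extends_to_surj_endo V E A f)"

end

theory Submission
  imports Defs "HOL-Library.Ramsey"
begin

text \<open>
  A homomorphism is turned into a monomorphism with the same image by restricting it to a
  transversal of its fibres, so one-point extensions of homomorphisms cost nothing. The difficulty
  is to extend backwards: given a finite homomorphism \<open>f\<close> and a vertex \<open>b\<close> outside its image, find a
  new vertex that is non-adjacent to the set \<open>X\<close> of all \<open>x\<close> with \<open>f x\<close> non-adjacent to \<open>b\<close>.

  Read in the complement graph \<open>R\<close>, surjectivity in the definition of ME-homogeneity says that finite
  bijections preserving \<open>R\<close> extend injectively to one more point, and a common \<open>R\<close>-neighbour (a cone)
  of \<open>X\<close> is wanted. If not every finite set has a cone and not every finite set has an anticone, the
  cliques of \<open>R\<close> have bounded size; a maximal clique with at least two points could be enlarged, so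
  \<open>R\<close> is empty. If every finite set has an anticone, then either the non-isolated part of \<open>R\<close> is a
  disjoint union of cliques, or some independent pair has a cone. In the latter case independent
  sets of every size \<open>n\<close> have cones, hence so do all finite sets, because an independent set maps
  onto any set of the same size. The step from \<open>n\<close> to \<open>n + 1\<close> is the heart of the proof: if \<open>R\<close> had no
  induced star with \<open>n + 1\<close> leaves, one could choose \<open>n\<close>-subsets \<open>S1\<close>, \<open>S2\<close>, \<open>S3\<close> of a large independent
  set, pairwise intersecting but with empty intersection, with pairwise adjacent cones \<open>x1\<close>, \<open>x2\<close>,
  \<open>x3\<close>. A cone \<open>y\<close> of \<open>x1\<close>, \<open>x2\<close>, \<open>x3\<close> and \<open>n - 1\<close> further independent points is adjacent to at most one
  point of the \<open>Si\<close>, so it misses some \<open>Si\<close>, and \<open>xi\<close> is the centre of a forbidden star.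
\<close>

section \<open>One-point extension of finite injections in the complement graph\<close>

locale injective_extension =
  fixes V :: "'a set" and R :: "'a \<Rightarrow> 'a \<Rightarrow> bool"
  assumes R_in: "R x y \<Longrightarrow> x \<in> V"
    and R_sym: "R x y \<Longrightarrow> R y x"
    and R_irrefl: "\<not> R x x"
    and ext: "\<lbrakk>finite S; S \<subseteq> V; inj_on j S; j ` S \<subseteq> V;
      \<And>s t. \<lbrakk>s \<in> S; t \<in> S; R s t\<rbrakk> \<Longrightarrow> R (j s) (j t); b \<in> V - S\<rbrakk>
      \<Longrightarrow> \<exists>a \<in> V - j ` S. \<forall>s\<in>S. R b s \<longrightarrow> R a (j s)"
begin

definition stable :: "'a set \<Rightarrow> bool" where
  "stable I \<longleftrightarrow> I \<subseteq> V \<and> (\<forall>x\<in>I. \<forall>y\<in>I. \<not> R x y)"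

definition complete :: "'a set \<Rightarrow> bool" where
  "complete K \<longleftrightarrow> K \<subseteq> V \<and> (\<forall>x\<in>K. \<forall>y\<in>K. x \<noteq> y \<longrightarrow> R x y)"

definition cone :: "'a \<Rightarrow> 'a set \<Rightarrow> bool" where
  "cone c S \<longleftrightarrow> c \<in> V \<and> (\<forall>s\<in>S. R c s)"

lemma stable_subset: "\<lbrakk>stable I; J \<subseteq> I\<rbrakk> \<Longrightarrow> stable J"
  unfolding stable_def by blast

lemma cone_transfer:
  assumes "finite S" "S \<subseteq> V" "inj_on j S" "j ` S \<subseteq> V"
    "\<And>s t. \<lbrakk>s \<in> S; t \<in> S; R s t\<rbrakk> \<Longrightarrow> R (j s) (j t)" "cone c S"
  shows "\<exists>a. cone a (j ` S)"
proof -
  have "c \<in> V - S" using assms(6) R_irrefl by (auto simp: cone_def)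
  from ext[OF assms(1-5) this] show ?thesis
    using assms(6) by (auto simp: cone_def)
qed

text \<open>Iterates \<open>ext\<close>: each point of \<open>M\<close> outside \<open>S\<close>
  gets an image outside the current range, so injectivity survives.\<close>

lemma extend_finite:
  assumes "finite S" "S \<subseteq> V" "inj_on j S" "j ` S \<subseteq> V"
    "\<And>s t. \<lbrakk>s \<in> S; t \<in> S; R s t\<rbrakk> \<Longrightarrow> R (j s) (j t)" "finite M" "M \<subseteq> V"
  shows "\<exists>j'. inj_on j' (S \<union> M) \<and> j' ` (S \<union> M) \<subseteq> V \<and> (\<forall>s\<in>S. j' s = j s) \<and>
      (\<forall>s\<in>S \<union> M. \<forall>t\<in>S \<union> M. R s t \<longrightarrow> R (j' s) (j' t))"
  using assms(6,7)
proof (induction M rule: finite_induct)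
  case empty
  then show ?case using assms(3-5) by (intro exI[of _ j]) simp
next
  case (insert m M)
  then obtain i where i: "inj_on i (S \<union> M)" "i ` (S \<union> M) \<subseteq> V" "\<And>s. s \<in> S \<Longrightarrow> i s = j s"
    "\<And>s t. \<lbrakk>s \<in> S \<union> M; t \<in> S \<union> M; R s t\<rbrakk> \<Longrightarrow> R (i s) (i t)" by auto
  show ?case
  proof (cases "m \<in> S")
    case True
    then have "S \<union> insert m M = S \<union> M" by auto
    then show ?thesis using i by (intro exI[of _ i]) simp
  next
    case False
    have fin: "finite (S \<union> M)" "S \<union> M \<subseteq> V" "m \<in> V - (S \<union> M)"
      using insert assms(1,2) False by auto
    from ext[OF fin(1,2) i(1,2,4) fin(3)]
    obtain a where a: "a \<in> V - i ` (S \<union> M)" "\<And>s. \<lbrakk>s \<in> S \<union> M; R m s\<rbrakk> \<Longrightarrow> R a (i s)"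
      by blast
    define i' where "i' = i(m := a)"
    have i': "i' m = a" "\<And>s. s \<in> S \<union> M \<Longrightarrow> i' s = i s"
      using fin(3) by (auto simp: i'_def)
    have "R (i' s) (i' t)" if st: "s \<in> insert m (S \<union> M)" "t \<in> insert m (S \<union> M)" "R s t" for s t
    proof -
      consider "s = m" "t \<in> S \<union> M" | "t = m" "s \<in> S \<union> M" | "s \<in> S \<union> M" "t \<in> S \<union> M"
        using st R_irrefl by blast
      then show ?thesis
      proof cases
        case 1
        then show ?thesis using a(2) i' st(3) by simp
      next
        case 2
        then show ?thesis using R_sym[OF a(2)] R_sym[OF st(3)] i' by simp
      next
        case 3
        then show ?thesis using i(4) i'(2) st(3) by simp
      qed
    qed
    moreover have img: "i' ` (S \<union> M) = i ` (S \<union> M)" using i'(2) by (intro image_cong) auto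
    moreover have "inj_on i' (S \<union> M)" using i(1) i'(2) inj_on_cong[of "S \<union> M" i' i] by simp
    ultimately show ?thesis
      using a(1) i(2,3) i' fin(3) by (intro exI[of _ i']) (simp add: inj_on_insert)
  qed
qed

lemma complete_bound_le_1:
  assumes "infinite V" and bound: "\<And>K. \<lbrakk>finite K; complete K\<rbrakk> \<Longrightarrow> card K \<le> N"
  shows "\<not> R x y"
proof
  assume "R x y"
  have "\<exists>K. (finite K \<and> complete K) \<and> (\<forall>L. finite L \<and> complete L \<longrightarrow> card L \<le> card K)"
    by (rule ex_has_greatest_nat[where k = "{}" and b = "Suc N"])
      (auto simp: complete_def bound less_Suc_eq_le intro!: bound)
  then obtain K where K: "finite K" "complete K"
    and max: "\<And>L. \<lbrakk>finite L; complete L\<rbrakk> \<Longrightarrow> card L \<le> card K" by blast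
  have "complete {x, y}" "x \<noteq> y"
    using \<open>R x y\<close> R_in R_sym R_irrefl by (auto simp: complete_def)
  with max[of "{x, y}"] have "2 \<le> card K" by simp
  then obtain p q where pq: "p \<in> K" "q \<in> K" "p \<noteq> q"
    by (metis K(1) card_le_Suc0_iff_eq not_less_eq_eq numeral_2_eq_2)
  define K' where "K' = K - {p}"
  have K': "finite K'" "complete K'" "p \<notin> K'" "q \<in> K'" "K' \<subseteq> V" "p \<in> V"
    using K pq by (auto simp: K'_def complete_def)
  obtain u where u: "u \<in> V" "u \<notin> K" using assms(1) K(1)
    by (metis finite_subset subsetI)
  have p_R: "R p s" if "s \<in> K'" for s
    using that K(2) pq by (auto simp: K'_def complete_def)
  txt \<open>A second common neighbour of \<^term>\<open>K'\<close>, obtained from a bijection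
    \<^term>\<open>insert u K' \<rightarrow> K\<close> that fixes \<^term>\<open>K'\<close>; mapping the non-adjacent pair
    of common neighbours onto an edge then produces a larger complete set.\<close>
  have "\<exists>p'. p' \<in> V \<and> p' \<notin> K \<and> (\<forall>s\<in>K'. R p' s)"
  proof -
    define j where "j z = (if z = u then p else z)" for z
    have img: "j ` insert u K' = K"
      using u pq by (auto simp: K'_def j_def)
    have inj: "inj_on j (insert u K')" using K' u by (auto simp: inj_on_def j_def)
    have jV: "j ` insert u K' \<subseteq> V" unfolding img using K(2) by (simp add: complete_def)
    \<comment> \<open>The range of \<open>j\<close> is the clique \<open>K\<close>, so injectivity
      alone makes \<open>j\<close> preserve \<open>R\<close>.\<close>
    have mono: "R (j s) (j t)" if st: "s \<in> insert u K'" "t \<in> insert u K'" "R s t" for s t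
    proof -
      have "s \<noteq> t" using st(3) R_irrefl by blast
      then have "j s \<noteq> j t" using inj_on_eq_iff[OF inj st(1,2)] by simp
      moreover have "j s \<in> K" "j t \<in> K"
        using imageI[OF st(1), of j] imageI[OF st(2), of j] by (simp_all only: img)
      ultimately show ?thesis using K(2) by (simp add: complete_def)
    qed
    have "finite (insert u K')" "insert u K' \<subseteq> V" "p \<in> V - insert u K'"
      using K' u pq by auto
    from ext[OF this(1,2) inj jV mono this(3)]
    obtain p' where p': "p' \<in> V - K" "\<forall>s\<in>insert u K'. R p s \<longrightarrow> R p' (j s)"
      unfolding img by blast
    have "R p' s" if "s \<in> K'" for s
      using that p'(2) u p_R[OF that] by (auto simp: K'_def j_def split: if_splits)
    then show ?thesis using p'(1) by blast
  qed
  then obtain p' where p': "p' \<in> V" "p' \<notin> K" "\<And>s. s \<in> K' \<Longrightarrow> R p' s" by blast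
  have card_K: "card K = Suc (card K')"
    using card.remove[OF K(1) pq(1)] by (simp add: K'_def)
  \<comment> \<open>A clique of maximum size has no cone; nonemptiness of \<open>L\<close> is what
    puts \<open>z\<close> into \<open>V\<close>.\<close>
  have enlarge: "\<not> (\<forall>s\<in>L. R z s)" if "finite L" "complete L" "card L = card K" for z L
  proof
    assume z: "\<forall>s\<in>L. R z s"
    have "L \<noteq> {}" using that \<open>2 \<le> card K\<close> by auto
    then have "complete (insert z L)" "z \<notin> L"
      using z that(2) R_in R_sym R_irrefl by (auto simp: complete_def)
    with max[of "insert z L"] that show False by simp
  qed
  have npp': "\<not> R p p'"
  proof
    assume "R p p'"
    then have "\<forall>s\<in>K. R p' s" using p' R_sym by (auto simp: K'_def)
    with enlarge[of K] K show False by blast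
  qed
  \<comment> \<open>The pair \<open>p\<close>, \<open>p'\<close> carries no edge, so sending it onto
    the edge \<open>x\<close>, \<open>y\<close> preserves \<open>R\<close> vacuously.\<close>
  define e where "e z = (if z = p then x else y)" for z
  have "p \<noteq> p'" using pq p' by auto
  then have "e p = x" "e p' = y" by (auto simp: e_def)
  have e: "inj_on e {p, p'}" "e ` {p, p'} \<subseteq> V"
    using \<open>e p = x\<close> \<open>e p' = y\<close> \<open>x \<noteq> y\<close> \<open>complete {x, y}\<close> by (auto simp: complete_def)
  have "R (e s) (e t)" if "s \<in> {p, p'}" "t \<in> {p, p'}" "R s t" for s t
    using that npp' R_irrefl R_sym by blast
  from extend_finite[OF _ _ e this K'(1,5)] K'(6) p'(1)
  obtain j where j: "inj_on j ({p, p'} \<union> K')" "j ` ({p, p'} \<union> K') \<subseteq> V" "\<forall>s\<in>{p, p'}. j s = e s"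
    "\<And>s t. \<lbrakk>s \<in> {p, p'} \<union> K'; t \<in> {p, p'} \<union> K'; R s t\<rbrakk> \<Longrightarrow> R (j s) (j t)" by blast
  have jp: "j p = x" "j p' = y" using j(3) \<open>e p = x\<close> \<open>e p' = y\<close> by auto
  have xK: "R x s" "R y s" if "s \<in> j ` K'" for s
    using that j(4)[of p] j(4)[of p'] p_R p'(3) jp by auto
  define L where "L = insert x (j ` K')"
  have "R (j s) (j t)" if st: "s \<in> K'" "t \<in> K'" "j s \<noteq> j t" for s t
  proof -
    have "s \<noteq> t" using st(3) by auto
    then have "R s t" using st(1,2) K'(2) by (simp add: complete_def)
    then show ?thesis using j(4) st(1,2) by simp
  qed
  moreover have "L \<subseteq> V" using j(2) jp by (auto simp: L_def)
  ultimately have "complete L"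
    unfolding complete_def L_def using xK(1) R_sym by blast
  moreover have "card L = card K"
  proof -
    have "x \<notin> j ` K'" using xK R_irrefl by blast
    moreover have "inj_on j K'" using j(1) by (auto simp: inj_on_Un)
    ultimately show ?thesis using K'(1) card_K by (simp add: L_def card_image)
  qed
  moreover have "\<forall>s\<in>L. R y s"
    using xK(2) R_sym[OF \<open>R x y\<close>] by (auto simp: L_def)
  moreover have "finite L" using K'(1) by (simp add: L_def)
  ultimately show False using enlarge by blast
qed

end

section \<open>Independent sets and transfer of their cones when finite sets have anticones\<close>

locale anticone_extension = injective_extension +
  assumes anticone: "\<lbrakk>finite F; F \<subseteq> V\<rbrakk> \<Longrightarrow> \<exists>v\<in>V - F. \<forall>x\<in>F. \<not> R v x"
begin

text \<open>Anticones are added one at a time, each taken over \<open>F\<close> and the points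
  already chosen.\<close>

lemma fresh:
  assumes "finite F" "F \<subseteq> V"
  shows "\<exists>U. finite U \<and> card U = r \<and> stable U \<and> U \<inter> F = {} \<and> (\<forall>u\<in>U. \<forall>x\<in>F. \<not> R u x)"
proof (induction r)
  case 0
  show ?case by (intro exI[of _ "{}"]) (auto simp: stable_def)
next
  case (Suc r)
  then obtain U where U: "finite U" "card U = r" "stable U" "U \<inter> F = {}" "\<forall>u\<in>U. \<forall>x\<in>F. \<not> R u x"
    by blast
  then obtain v where v: "v \<in> V - (F \<union> U)" "\<forall>x\<in>F \<union> U. \<not> R v x"
    using anticone[of "F \<union> U"] assms by (auto simp: stable_def)
  have "stable (insert v U)" using v U(3) R_sym R_irrefl by (auto simp: stable_def)
  then show ?case using U v by (intro exI[of _ "insert v U"]) auto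
qed

lemma fresh_stable:
  assumes "finite F" "stable F"
  shows "\<exists>U. finite U \<and> card U = r \<and> U \<inter> F = {} \<and> stable (U \<union> F)"
proof -
  have "F \<subseteq> V" using assms(2) by (simp add: stable_def)
  from fresh[OF assms(1) this]
  obtain U where U: "finite U" "card U = r" "stable U" "U \<inter> F = {}" "\<forall>u\<in>U. \<forall>x\<in>F. \<not> R u x"
    by blast
  then have "stable (U \<union> F)" using assms(2) R_sym unfolding stable_def by blast
  with U show ?thesis by blast
qed

text \<open>An independent set has no edges to preserve, so any bijection from it carries its cone
  along.\<close>

lemma stable_transfer:
  assumes "stable I" "finite I" "cone c I" "S \<subseteq> V" "finite S" "card S = card I"
  shows "\<exists>a. cone a S"
proof -
  obtain h where h: "bij_betw h I S"
    using finite_same_card_bij assms by metis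
  then have eq: "h ` I = S" and inj: "inj_on h I" by (auto simp: bij_betw_def)
  show ?thesis
    using cone_transfer[OF assms(2) _ inj _ _ assms(3)] assms(1,4) eq
    by (auto simp: stable_def)
qed

text \<open>\<open>ext\<close> keeps the new point out of the range only. Fresh points
  \<open>U\<close>, independent of \<open>I\<close>, are therefore mapped onto \<open>A - X\<close>,
  which makes all of \<open>A\<close> the range.\<close>

lemma cone_avoiding:
  assumes "stable I" "finite I" "cone c I" "X \<subseteq> A" "A \<subseteq> V" "finite A" "card X = card I"
  shows "\<exists>a. cone a X \<and> a \<notin> A"
proof -
  have cI: "c \<in> V" "c \<notin> I" "I \<subseteq> V" using assms(1,3) R_irrefl by (auto simp: cone_def stable_def)
  obtain U where U: "finite U" "card U = card (A - X)" "stable U" "U \<inter> (insert c I) = {}"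
    "\<forall>u\<in>U. \<forall>x\<in>insert c I. \<not> R u x"
    using fresh[of "insert c I" "card (A - X)"] assms(2) cI by auto
  have fin: "finite X" "finite (A - X)" using assms finite_subset by auto
  obtain g where g: "bij_betw g I X" using finite_same_card_bij assms(2,7) fin by metis
  obtain h where h: "bij_betw h U (A - X)" using finite_same_card_bij U fin by metis
  define j where "j z = (if z \<in> I then g z else h z)" for z
  have jI: "bij_betw j I X" using g by (simp add: j_def cong: bij_betw_cong)
  have jU: "bij_betw j U (A - X)"
    using h U(4) by (subst bij_betw_cong[of U j h]) (auto simp: j_def)
  have bij: "bij_betw j (I \<union> U) A"
    using bij_betw_combine[OF jI jU] assms(4) by (simp add: Un_absorb1)
  then have eq: "j ` (I \<union> U) = A" and inj: "inj_on j (I \<union> U)" by (auto simp: bij_betw_def)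
  have no: "\<not> R s t" if "s \<in> I \<union> U" "t \<in> I \<union> U" for s t
    using that U(3,5) assms(1) R_sym by (auto simp: stable_def)
  obtain a where a: "a \<in> V - A" "\<forall>s\<in>I \<union> U. R c s \<longrightarrow> R a (j s)"
    using ext[of "I \<union> U" j c] eq inj no U(1,3,4) cI assms by (auto simp: stable_def)
  have "R a x" if x: "x \<in> X" for x
  proof -
    obtain i where "i \<in> I" "x = j i" using x jI by (auto simp: bij_betw_def)
    then show ?thesis using a(2) assms(3) by (auto simp: cone_def)
  qed
  then show ?thesis using a(1) by (auto simp: cone_def)
qed

end

section \<open>Refuting a bound \<open>n\<close> on the number of leaves of induced stars\<close>

locale bounded_star = anticone_extension +
  fixes n :: nat
  assumes n2: "n \<ge> 2"
    and star: "\<exists>I c. finite I \<and> stable I \<and> card I = n \<and> cone c I"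
    and no_star: "\<lbrakk>finite I; stable I; card I = Suc n\<rbrakk> \<Longrightarrow> \<not> cone c I"
begin

lemma cone_n:
  assumes "finite S" "S \<subseteq> V" "card S = n"
  shows "\<exists>c. cone c S"
  using star stable_transfer[of _ _ S] assms by metis

text \<open>The cones \<^term>\<open>D\<close> lie in the neighbourhood of \<^term>\<open>z\<close>, so Ramsey's theorem and the absence of
  large stars will yield cliques among them.\<close>

lemma many_cones:
  assumes "z \<in> V"
  shows "\<exists>D I. finite D \<and> card D = r \<and> finite I \<and> stable (insert z I) \<and> z \<notin> I \<and>
    (\<forall>d\<in>D. R z d \<and> (\<exists>T\<subseteq>I. card T = n - 1 \<and> (\<forall>t\<in>T. R d t) \<and> (\<forall>d'\<in>D - {d}. \<forall>t\<in>T. \<not> R d' t)))"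
proof (induction r)
  case 0
  show ?case using assms R_irrefl
    by (intro exI[of _ "{}"] exI[of _ "{}"]) (auto simp: stable_def)
next
  case (Suc r)
  then obtain D I where D: "finite D" "card D = r" "finite I" "stable (insert z I)" "z \<notin> I"
    "\<forall>d\<in>D. R z d \<and>
      (\<exists>T\<subseteq>I. card T = n - 1 \<and> (\<forall>t\<in>T. R d t) \<and> (\<forall>d'\<in>D - {d}. \<forall>t\<in>T. \<not> R d' t))"
    by (elim exE conjE) (rule that)
  let ?F = "insert z I \<union> D"
  have Dz: "R z d" if "d \<in> D" for d using D(6) that by blast
  have DT: "\<exists>T\<subseteq>I. card T = n - 1 \<and> (\<forall>t\<in>T. R d t) \<and> (\<forall>d'\<in>D - {d}. \<forall>t\<in>T. \<not> R d' t)"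
    if "d \<in> D" for d using D(6) that by blast
  have "D \<subseteq> V" using Dz R_in R_sym by blast
  then have "?F \<subseteq> V" using D(4) by (auto simp: stable_def)
  then obtain U where U: "finite U" "card U = n - 1" "stable U" "U \<inter> ?F = {}" "\<forall>u\<in>U. \<forall>x\<in>?F. \<not> R u x"
    using fresh[of ?F "n - 1"] D(1,3) by auto
  obtain c where c: "cone c (insert z U)"
    using cone_n[of "insert z U"] U assms n2 by (auto simp: stable_def)
  \<comment> \<open>\<open>insert z U\<close> already gives \<open>c\<close> its \<open>n\<close>
    independent neighbours; \<open>t\<close> would be one too many.\<close>
  have cI: "\<not> R c t" if "t \<in> I" for t
  proof
    assume "R c t"
    have "stable (insert t (insert z U))"
      using that U(3,5) D(4) R_sym R_irrefl by (auto simp: stable_def)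
    moreover have "card (insert t (insert z U)) = Suc n"
    proof -
      have "t \<notin> insert z U" "z \<notin> U" using that U(4) D(5) by auto
      then show ?thesis using U(1,2) n2 by simp
    qed
    ultimately show False
      using no_star[of "insert t (insert z U)" c] c \<open>R c t\<close> U(1) by (auto simp: cone_def)
  qed
  \<comment> \<open>\<open>U\<close> is nonempty as \<open>n \<ge> 2\<close>, and its points are
    joined to \<open>c\<close> but to nothing in \<open>D\<close>.\<close>
  obtain u where "u \<in> U" using U(2) n2 by fastforce
  then have "c \<notin> D" using c U(5) R_sym unfolding cone_def by blast
  have cz: "R z c" using c R_sym by (auto simp: cone_def)
  have "stable (insert z (I \<union> U))"
    using D(4) U(3,5) R_sym by (auto simp: stable_def)
  \<comment> \<open>The private set of \<open>c\<close> is \<open>U\<close>; the earlier cones keep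
    theirs, because \<open>c\<close> misses all of \<open>I\<close>.\<close>
  moreover have "\<exists>T\<subseteq>I \<union> U. card T = n - 1 \<and> (\<forall>t\<in>T. R d t) \<and> (\<forall>d'\<in>insert c D - {d}. \<forall>t\<in>T. \<not> R d' t)"
    if d: "d \<in> insert c D" for d
  proof (cases "d = c")
    case True
    have "\<forall>d'\<in>insert c D - {c}. \<forall>t\<in>U. \<not> R d' t" using U(5) R_sym by blast
    moreover have "\<forall>t\<in>U. R c t" using c by (auto simp: cone_def)
    ultimately show ?thesis using True U(2) by blast
  next
    case False
    then obtain T where "T \<subseteq> I" "card T = n - 1" "\<forall>t\<in>T. R d t" "\<forall>d'\<in>D - {d}. \<forall>t\<in>T. \<not> R d' t"
      using DT[of d] d by (elim exE conjE insertE) auto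
    moreover have "\<forall>t\<in>T. \<not> R c t" using cI \<open>T \<subseteq> I\<close> by blast
    ultimately show ?thesis by (intro exI[of _ T]) auto
  qed
  moreover have "card (insert c D) = Suc r" using D(1,2) \<open>c \<notin> D\<close> by simp
  moreover have "z \<notin> I \<union> U" using D(5) U(4) by blast
  moreover have "R z d" if "d \<in> insert c D" for d using that Dz cz by blast
  ultimately show ?case
    using D(1,3) U(1) by (intro exI[of _ "insert c D"] exI[of _ "I \<union> U"]) simp
qed

text \<open>Among many cones joined to \<open>z\<close>, Ramsey gives a clique of size
  \<open>m + 1\<close>, since \<open>n + 1\<close> independent ones would form a star at
  \<open>z\<close>. One member \<open>c\<close> is a cone over the remaining clique \<open>C\<close>
  and over its own private set \<open>T\<close>. No edges join \<open>C\<close> to \<open>T\<close>,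
  so a bijection onto \<open>D \<union> W\<close> sending \<open>C\<close> to \<open>D\<close>
  preserves \<open>R\<close>.\<close>

lemma clique_cone:
  assumes D: "finite D" "complete D" "card D = m"
    and W: "finite W" "W \<subseteq> V" "card W = n - 1" "W \<inter> D = {}"
  shows "\<exists>c. cone c (D \<union> W)"
proof -
  obtain r where r: "\<forall>(X :: 'a set) F. finite X \<and> r \<le> card X \<longrightarrow>
      (\<exists>Y\<subseteq>X. card Y = Suc m \<and> clique Y F \<or> card Y = Suc n \<and> indep Y F)"
    using ramsey2[of "Suc m" "Suc n", where 'a = 'a] by (elim exE conjE) (rule that)
  obtain z where z: "z \<in> V" using anticone[of "{}"] by auto
  obtain X I where X: "finite X" "card X = r" "finite I" "stable (insert z I)" "z \<notin> I"
    "\<forall>d\<in>X. R z d \<and>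
      (\<exists>T\<subseteq>I. card T = n - 1 \<and> (\<forall>t\<in>T. R d t) \<and> (\<forall>d'\<in>X - {d}. \<forall>t\<in>T. \<not> R d' t))"
    using many_cones[OF z, of r] by (elim exE conjE) (rule that)
  have XV: "X \<subseteq> V" using X(6) R_sym R_in by blast
  define F where "F = {{a, b} |a b. R a b}"
  have F: "{a, b} \<in> F \<longleftrightarrow> R a b" for a b
    using R_sym by (auto simp: F_def doubleton_eq_iff)
  obtain Y where Y: "Y \<subseteq> X" "card Y = Suc m \<and> clique Y F \<or> card Y = Suc n \<and> indep Y F"
    using r X(1,2) by (metis order_refl)
  have "\<not> (card Y = Suc n \<and> indep Y F)"
  proof
    assume as: "card Y = Suc n \<and> indep Y F"
    have "stable Y"
      using as Y(1) XV R_irrefl by (auto simp: stable_def indep_def F) metis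
    moreover have "cone z Y" using z X(6) Y(1) by (auto simp: cone_def)
    ultimately show False using no_star[of Y z] as Y(1) X(1) finite_subset by blast
  qed
  with Y have Yc: "card Y = Suc m" "clique Y F" by auto
  then obtain c where c: "c \<in> Y" by fastforce
  define C where "C = Y - {c}"
  have finC: "finite C" "card C = m"
    using Yc c Y(1) X(1) finite_subset by (auto simp: C_def)
  obtain T where T: "T \<subseteq> I" "card T = n - 1" "\<forall>t\<in>T. R c t" "\<forall>d'\<in>X - {c}. \<forall>t\<in>T. \<not> R d' t"
    using X(6) c Y(1) by (meson subsetD)
  have finT: "finite T" using T(1) X(3) finite_subset by blast
  have cone: "cone c (C \<union> T)"
    using T(3) Yc(2) c XV Y(1) by (auto simp: cone_def C_def clique_def F)
  \<comment> \<open>Separates \<open>T\<close> from \<open>C\<close>, whose points are all joined to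
    \<open>z\<close>.\<close>
  have "\<not> R z t" if "t \<in> T" for t using X(4) T(1) that by (auto simp: stable_def)
  then have disj: "C \<inter> T = {}" "\<And>d t. \<lbrakk>d \<in> C; t \<in> T\<rbrakk> \<Longrightarrow> \<not> R d t"
    using X(6) T(4) Y(1) unfolding C_def by blast+
  obtain g where g: "bij_betw g C D" using finite_same_card_bij finC D by metis
  obtain h where h: "bij_betw h T W" using finite_same_card_bij T(2) finT W by metis
  define j where "j v = (if v \<in> C then g v else h v)" for v
  have jC: "bij_betw j C D" using g by (simp add: j_def cong: bij_betw_cong)
  have jT: "bij_betw j T W"
    using h disj(1) by (subst bij_betw_cong[of T j h]) (auto simp: j_def)
  have bij: "bij_betw j (C \<union> T) (D \<union> W)"
    using bij_betw_combine[OF jC jT] W(4) by blast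
  then have eq: "j ` (C \<union> T) = D \<union> W" and inj: "inj_on j (C \<union> T)" by (auto simp: bij_betw_def)
  have mono: "R (j s) (j t)" if st: "s \<in> C \<union> T" "t \<in> C \<union> T" "R s t" for s t
  proof -
    have "\<not> (s \<in> T \<and> t \<in> T)" using T(1) X(4) st(3) unfolding stable_def by blast
    then have "s \<in> C" "t \<in> C" using st disj(2) R_sym by blast+
    moreover have "s \<noteq> t" using st(3) R_irrefl by auto
    ultimately have "j s \<in> D" "j t \<in> D" "j s \<noteq> j t"
      using jC by (auto simp: bij_betw_def inj_on_def)
    then show ?thesis using D(2) by (auto simp: complete_def)
  qed
  have "C \<union> T \<subseteq> V" using XV Y(1) T(1) X(4) by (auto simp: C_def stable_def)
  from cone_transfer[OF _ this inj _ mono cone] show ?thesis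
    using eq finC(1) finT D(2) W(2) by (auto simp: complete_def)
qed

lemma edge_cone:
  assumes "R a b" "finite W" "W \<subseteq> V" "card W = n - 1" "a \<notin> W" "b \<notin> W"
  shows "\<exists>c. cone c ({a, b} \<union> W)"
proof (rule clique_cone[where m = 2])
  show "complete {a, b}" using assms(1) R_in R_sym by (auto simp: complete_def)
  have "a \<noteq> b" using assms(1) R_irrefl by blast
  then show "card {a, b} = 2" by simp
qed (use assms in auto)

text \<open>A cone \<open>d\<close> over the edge and \<open>n - 1\<close> fresh points has
  \<open>n\<close> independent neighbours in \<open>insert p U\<close>. A further neighbour
  \<open>q\<close> not joined to \<open>p\<close> would complete a star with \<open>n + 1\<close>
  leaves.\<close>

lemma private_cone:
  assumes "R z p" "finite F" "F \<subseteq> V"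
  shows "\<exists>d. R d z \<and> R d p \<and> d \<notin> F \<and> (\<forall>q\<in>F. q \<noteq> p \<longrightarrow> \<not> R q p \<longrightarrow> \<not> R d q)"
proof -
  have zp: "z \<in> V" "p \<in> V" using assms(1) R_in R_sym by blast+
  obtain U where U: "finite U" "card U = n - 1" "stable U" "U \<inter> ({z, p} \<union> F) = {}"
    "\<forall>u\<in>U. \<forall>x\<in>{z, p} \<union> F. \<not> R u x"
    using fresh[of "{z, p} \<union> F" "n - 1"] assms zp by auto
  obtain d where d: "cone d ({z, p} \<union> U)"
    using edge_cone[of z p U] assms(1) U by (auto simp: stable_def)
  obtain u where "u \<in> U" using U(2) n2 by fastforce
  then have "d \<notin> F" using d U(5) R_sym unfolding cone_def by blast
  moreover have "\<not> R d q" if q: "q \<in> F" "q \<noteq> p" "\<not> R q p" for q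
  proof
    assume "R d q"
    have "stable (insert q (insert p U))"
      using q assms(3) zp U(3,5) R_sym R_irrefl unfolding stable_def by blast
    moreover have "card (insert q (insert p U)) = Suc n"
    proof -
      have "q \<notin> insert p U" "p \<notin> U" using q U(4) by auto
      then show ?thesis using U(1,2) n2 by simp
    qed
    ultimately show False
      using no_star[of "insert q (insert p U)" d] d \<open>R d q\<close> U(1) by (auto simp: cone_def)
  qed
  ultimately show ?thesis using d by (auto simp: cone_def)
qed

text \<open>The cone is transferred from a star with centre \<open>z\<close> and leaves
  \<open>P\<close>: private cones \<open>d1\<close>, \<open>d2\<close> of the edges from
  \<open>z\<close> to \<open>p1\<close>, \<open>p2\<close> give two disjoint edges, and with the
  other leaves \<open>Q\<close> they form a set below \<open>z\<close> whose only edges are these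
  two.\<close>

lemma two_edges_cone:
  assumes "R a1 b1" "R a2 b2" "distinct [a1, b1, a2, b2]"
    and W: "finite W" "W \<subseteq> V" "card W = n - 2" "{a1, b1, a2, b2} \<inter> W = {}"
  shows "\<exists>c. cone c ({a1, b1, a2, b2} \<union> W)"
proof -
  obtain P where P: "finite P" "card P = n" "stable P"
    using fresh[of "{}" n] by auto
  then obtain z where z: "cone z P" using cone_n[of P] by (auto simp: stable_def)
  obtain p1 p2 where p: "p1 \<in> P" "p2 \<in> P" "p1 \<noteq> p2"
    by (metis P(1,2) n2 card_le_Suc0_iff_eq not_less_eq_eq numeral_2_eq_2)
  define Q where "Q = P - {p1, p2}"
  have Q: "finite Q" "card Q = n - 2" "p1 \<notin> Q" "p2 \<notin> Q"
    using P p by (auto simp: Q_def card_Diff_subset)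
  have nP: "\<not> R q q'" "q \<in> V" if "q \<in> P" "q' \<in> P" for q q'
    using P(3) that by (auto simp: stable_def)
  have zp: "R z p1" "R z p2" using z p by (auto simp: cone_def)
  obtain d1 where d1: "R d1 z" "R d1 p1" "d1 \<notin> P"
    "\<And>q. \<lbrakk>q \<in> P; q \<noteq> p1\<rbrakk> \<Longrightarrow> \<not> R d1 q"
    using private_cone[OF zp(1), of P] P nP p by (auto simp: stable_def)
  \<comment> \<open>Including \<open>d1\<close> in the set to be avoided makes \<open>d2\<close>
    distinct from \<open>d1\<close> and not joined to it.\<close>
  have "insert d1 P \<subseteq> V" "finite (insert d1 P)"
    using R_in[OF d1(1)] P(1,3) by (auto simp: stable_def)
  from private_cone[OF zp(2) this(2,1)]
  obtain d2 where d2': "R d2 z" "R d2 p2" "d2 \<notin> insert d1 P"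
    "\<forall>q\<in>insert d1 P. q \<noteq> p2 \<longrightarrow> \<not> R q p2 \<longrightarrow> \<not> R d2 q"
    by blast
  have d2: "\<not> R d2 q" if "q \<in> insert d1 P" "q \<noteq> p2" for q
    using that d2'(4) nP p d1(4)[of p2] by auto
  obtain h where h: "bij_betw h Q W" using finite_same_card_bij Q W by metis
  define j where "j v = (if v = p1 then a1 else if v = d1 then b1 else
      if v = p2 then a2 else if v = d2 then b2 else h v)" for v
  have ne: "d1 \<noteq> p1" "d1 \<noteq> p2" "d2 \<noteq> p1" "d2 \<noteq> p2" "d2 \<noteq> d1" "d1 \<notin> Q" "d2 \<notin> Q"
    using d1(3) d2'(3) p by (auto simp: Q_def)
  have jv: "j p1 = a1" "j d1 = b1" "j p2 = a2" "j d2 = b2"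
    using p ne by (auto simp: j_def)
  let ?B = "{p1, d1, p2, d2}"
  have jB: "bij_betw j ?B {a1, b1, a2, b2}"
    using jv assms(3) by (auto simp: bij_betw_def inj_on_def)
  have jQ: "bij_betw j Q W"
    using h ne Q by (subst bij_betw_cong[of Q j h]) (auto simp: j_def)
  have bij: "bij_betw j (?B \<union> Q) ({a1, b1, a2, b2} \<union> W)"
    using bij_betw_combine[OF jB jQ] W(4) by blast
  then have eq: "j ` (?B \<union> Q) = {a1, b1, a2, b2} \<union> W" and inj: "inj_on j (?B \<union> Q)"
    by (auto simp: bij_betw_def)
  have QP: "Q \<subseteq> P" by (auto simp: Q_def)
  have edges: "{s, t} = {p1, d1} \<or> {s, t} = {p2, d2}"
    if st: "s \<in> ?B \<union> Q" "t \<in> ?B \<union> Q" "R s t" for s t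
  proof -
    have "?B \<union> Q = insert d1 (insert d2 P)" using p by (auto simp: Q_def)
    with st have "s \<in> insert d1 (insert d2 P)" "t \<in> insert d1 (insert d2 P)" by auto
    then show ?thesis
      using st(3) R_irrefl R_sym nP(1) d1(4) d2 by blast
  qed
  have mono: "R (j s) (j t)" if st: "s \<in> ?B \<union> Q" "t \<in> ?B \<union> Q" "R s t" for s t
    using edges[OF st] jv assms(1,2) R_sym by (auto simp: doubleton_eq_iff)
  have sub: "?B \<union> Q \<subseteq> V"
    using R_in[OF d1(1)] R_in[OF d2'(1)] P(3) p by (auto simp: Q_def stable_def)
  have cone: "cone z (?B \<union> Q)"
    using z d1(1) d2'(1) R_sym p by (auto simp: cone_def Q_def)
  have "{a1, b1, a2, b2} \<subseteq> V"
    using assms(1,2) R_in R_sym by blast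
  then have "j ` (?B \<union> Q) \<subseteq> V" unfolding eq using W(2) by blast
  from cone_transfer[OF _ sub inj this mono cone] show ?thesis
    unfolding eq using Q(1) by blast
qed

lemma contradiction: False
proof -
  obtain P where P: "finite P" "card P = n - 2" "stable P"
    using fresh[of "{}" "n - 2"] by auto
  obtain Q where Q: "finite Q" "card Q = n - 2" "Q \<inter> P = {}" "stable (Q \<union> P)"
    using fresh_stable[OF P(1,3)] by blast
  then have "finite (Q \<union> P)" using P(1) by simp
  from fresh_stable[OF this Q(4)]
  obtain W where W: "finite W" "card W = n - 1" "W \<inter> (Q \<union> P) = {}" "stable (W \<union> (Q \<union> P))"
    by blast
  have "finite (W \<union> (Q \<union> P))" using W(1) Q(1) P(1) by simp
  from fresh_stable[OF this W(4)]
  obtain A where A: "finite A" "card A = 3" "A \<inter> (W \<union> (Q \<union> P)) = {}"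
    and st: "stable (A \<union> (W \<union> (Q \<union> P)))"
    by blast
  obtain a b c where abc: "A = {a, b, c}" "a \<noteq> b" "a \<noteq> c" "b \<noteq> c"
    using A(2) by (auto simp: card_3_iff)
  define Z where "Z = A \<union> (W \<union> (Q \<union> P))"
  have stZ: "stable Z" using st by (simp add: Z_def)
  then have ZV: "Z \<subseteq> V" and nZ: "\<And>s t. \<lbrakk>s \<in> Z; t \<in> Z\<rbrakk> \<Longrightarrow> \<not> R s t"
    by (auto simp: stable_def)
  have inZ: "a \<in> Z" "b \<in> Z" "c \<in> Z" "P \<subseteq> Z" "Q \<subseteq> Z" "W \<subseteq> Z"
    by (auto simp: Z_def abc)
  have nin: "a \<notin> P" "a \<notin> Q" "a \<notin> W" "b \<notin> P" "b \<notin> Q" "b \<notin> W" "c \<notin> P" "c \<notin> Q" "c \<notin> W"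
    using A(3) abc by auto
  \<comment> \<open>The shared points supply the edges for the next cones: \<open>b\<close> gives
    the edge from \<open>x1\<close> used for \<open>x2\<close>, while \<open>a\<close> and
    \<open>c\<close> give the edges from \<open>x1\<close> and \<open>x2\<close> used for
    \<open>x3\<close>. Using \<open>Q\<close> instead of \<open>P\<close> in \<open>S3\<close>
    empties the triple intersection.\<close>
  define S1 where "S1 = {a, b} \<union> P"
  define S2 where "S2 = {b, c} \<union> P"
  define S3 where "S3 = {a, c} \<union> Q"
  have S: "finite S1" "finite S2" "finite S3" "card S1 = n" "card S2 = n" "card S3 = n"
    using P(1,2) Q(1,2) nin abc n2 by (simp_all add: S1_def S2_def S3_def)
  have "P \<inter> W = {}" "Q \<inter> W = {}" using W(3) by blast+
  then have SZ: "S1 \<subseteq> Z - W" "S2 \<subseteq> Z - W" "S3 \<subseteq> Z - W"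
    using inZ nin unfolding S1_def S2_def S3_def by blast+
  have S123: "S1 \<inter> S2 \<inter> S3 = {}"
    using Q(3) nin abc unfolding S1_def S2_def S3_def by blast
  obtain x1 where x1: "cone x1 S1"
    using cone_n[of S1] S(1,4) SZ(1) ZV by blast
  have x1Z: "x1 \<notin> Z" using x1 nZ inZ by (auto simp: cone_def S1_def)
  have x1b: "R x1 b" "R x1 a" using x1 by (auto simp: cone_def S1_def)
  obtain x2 where x2: "cone x2 ({x1, b} \<union> insert c P)"
  proof -
    have "x1 \<notin> insert c P" "b \<notin> insert c P" "insert c P \<subseteq> V" "card (insert c P) = n - 1"
      using x1Z inZ ZV nin abc P(1,2) n2 by auto
    then show thesis using that edge_cone[of x1 b "insert c P"] x1b P(1) by blast
  qed
  have x2Z: "x2 \<notin> Z" and x2S: "cone x2 S2" and x12: "R x2 x1"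
    using x2 nZ inZ by (auto simp: cone_def S2_def)
  have "\<exists>x. cone x ({x1, a, x2, c} \<union> Q)"
  proof (rule two_edges_cone)
    show "R x2 c" using x2 by (auto simp: cone_def)
    show "distinct [x1, a, x2, c]" using x12 R_irrefl x1Z x2Z inZ abc by auto
  qed (use x1b x1Z x2Z inZ ZV nin Q in auto)
  then obtain x3 where x3: "cone x3 ({x1, a, x2, c} \<union> Q)" by blast
  have x3Z: "x3 \<notin> Z" and x3S: "cone x3 S3" and x13: "R x3 x1" "R x3 x2"
    using x3 nZ inZ by (auto simp: cone_def S3_def)
  have "\<exists>y. cone y ({x1, x2, x3} \<union> W)"
  proof (rule clique_cone)
    show "complete {x1, x2, x3}"
      using x12 x13 R_sym R_in by (auto simp: complete_def)
  qed (use W(1,2) inZ ZV x1Z x2Z x3Z in auto)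
  then obtain y where y: "cone y ({x1, x2, x3} \<union> W)" by blast
  obtain w where w: "w \<in> W" using W(2) n2 by fastforce
  then have "R y w" using y by (simp add: cone_def)
  then have yZ: "y \<notin> Z" using nZ inZ(6) w by blast
  \<comment> \<open>\<open>W\<close> provides \<open>n - 1\<close> independent neighbours of
    \<open>y\<close>, which leaves room for only one more.\<close>
  have unique: "s = t" if "s \<in> Z - W" "t \<in> Z - W" "R y s" "R y t" for s t
  proof (rule ccontr)
    assume "s \<noteq> t"
    then have card: "card (insert s (insert t W)) = Suc n" using that W(1,2) n2 by simp
    have "insert s (insert t W) \<subseteq> Z" using that(1,2) inZ(6) by blast
    then have "stable (insert s (insert t W))" by (rule stable_subset[OF stZ])
    moreover have "cone y (insert s (insert t W))" using that(3,4) y by (simp add: cone_def)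
    ultimately show False using no_star[OF _ _ card] W(1) by simp
  qed
  \<comment> \<open>If \<open>y\<close> missed \<open>S\<close>, it would be an additional leaf of
    the star at \<open>x\<close>.\<close>
  have hit: "\<exists>s\<in>S. R y s"
    if S: "finite S" "card S = n" "S \<subseteq> Z - W" "cone x S" "R y x" for x S
  proof (rule ccontr)
    assume no: "\<not> (\<exists>s\<in>S. R y s)"
    have "S \<subseteq> Z" using S(3) by blast
    then have "stable S" by (rule stable_subset[OF stZ])
    moreover have "y \<in> V" using y by (simp add: cone_def)
    ultimately have "stable (insert y S)"
      using no R_sym R_irrefl unfolding stable_def by blast
    moreover have "y \<notin> S" using \<open>S \<subseteq> Z\<close> yZ by blast
    then have "card (insert y S) = Suc n" using S(1,2) by simp
    moreover have "cone x (insert y S)" using S(4) R_sym[OF S(5)] by (simp add: cone_def)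
    ultimately show False using no_star[of "insert y S" x] S(1) by simp
  qed
  obtain s1 s2 s3 where s: "s1 \<in> S1" "R y s1" "s2 \<in> S2" "R y s2" "s3 \<in> S3" "R y s3"
    using hit[OF S(1,4) SZ(1) x1] hit[OF S(2,5) SZ(2) x2S] hit[OF S(3,6) SZ(3) x3S] y
    unfolding cone_def by blast
  then have "s1 = s2" "s2 = s3" using unique SZ by blast+
  then show False using s S123 by blast
qed

end

section \<open>Cones over arbitrary finite sets\<close>

context anticone_extension
begin

text \<open>A failing induction step is exactly an instance of \<open>bounded_star\<close>, which is
  contradictory.\<close>

lemma large_star:
  assumes "finite I" "stable I" "card I = 2" "cone c I" "2 \<le> n"
  shows "\<exists>I c. finite I \<and> stable I \<and> card I = n \<and> cone c I"
  using assms(5)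
proof (induction n rule: dec_induct)
  case base
  then show ?case using assms by blast
next
  case (step n)
  show ?case
  proof (rule ccontr)
    assume no: "\<not> ?case"
    interpret bounded_star V R n
    proof
      show "2 \<le> n" by (rule step(1))
      show "\<exists>I c. finite I \<and> stable I \<and> card I = n \<and> cone c I" by (rule step.IH)
      show "\<not> cone c I" if "finite I" "stable I" "card I = Suc n" for I c
        using no that by blast
    qed
    show False by (rule contradiction)
  qed
qed

lemma finite_cone:
  assumes "finite I" "stable I" "card I = 2" "cone c I" "X \<subseteq> A" "A \<subseteq> V" "finite A"
  shows "\<exists>a. cone a X \<and> a \<notin> A"
proof -
  have "finite X" using assms finite_subset by blast
  \<comment> \<open>\<open>large_star\<close> starts at two leaves, so a small \<open>X\<close> is
    padded first.\<close>
  obtain Y where Y: "X \<subseteq> Y" "Y \<subseteq> V" "finite Y" "2 \<le> card Y"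
  proof -
    obtain U where "finite U" "card U = 2" "stable U" using fresh[of "{}" 2] by auto
    then show thesis using that[of "X \<union> U"] assms \<open>finite X\<close> card_mono[of "X \<union> U" U]
      by (auto simp: stable_def)
  qed
  obtain J d where "finite J" "stable J" "card J = card Y" "cone d J"
    using large_star[OF assms(1-4) Y(4)] by blast
  from cone_avoiding[OF this(2,1,4), of Y "A \<union> Y"] this(3) Y assms
  obtain a where "cone a Y" "a \<notin> A \<union> Y" by auto
  then show ?thesis using Y(1) by (auto simp: cone_def)
qed

end

section \<open>ME-homogeneity expressed in the complement graph\<close>

definition non_adjacent :: "'a set \<Rightarrow> ('a \<Rightarrow> 'a \<Rightarrow> bool) \<Rightarrow> 'a \<Rightarrow> 'a \<Rightarrow> bool" where
  "non_adjacent V E x y \<longleftrightarrow> x \<in> V \<and> y \<in> V \<and> x \<noteq> y \<and> \<not> E x y"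

lemma ME_homogeneousD:
  assumes "ME_homogeneous V E" "finite A" "A \<subseteq> V" "graph_hom E A V f" "inj_on f A"
  obtains g where "graph_hom E V V g" "g ` V = V" "\<And>x. x \<in> A \<Longrightarrow> g x = f x"
proof -
  have "graph_mono E A (f ` A) f" "f ` A \<subseteq> V" "finite (f ` A)"
    using assms(2,4,5) by (auto simp: graph_mono_def graph_hom_def)
  then have "extends_to_surj_endo V E A f"
    using assms(1,2,3) unfolding ME_homogeneous_def by blast
  then show thesis using that unfolding extends_to_surj_endo_def by blast
qed

text \<open>Restricting to a transversal of the fibres turns a homomorphism into a monomorphism
  with the same image.\<close>

lemma ME_forward:
  assumes "ME_homogeneous V E" "finite A" "A \<subseteq> V" "graph_hom E A V f" "a \<in> V"
  shows "\<exists>c\<in>V. \<forall>x\<in>A. E a x \<longrightarrow> E c (f x)"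
proof -
  define N where "N = {x \<in> A. E a x}"
  \<comment> \<open>The transversal is taken inside the neighbourhood \<open>N\<close> of
    \<open>a\<close>, so every representative is itself adjacent to \<open>a\<close>.\<close>
  obtain T where T: "T \<subseteq> N" "inj_on f T" "f ` N = f ` T"
    using subset_image_inj[of "f ` N" f N] by blast
  have TA: "T \<subseteq> A" using T(1) by (auto simp: N_def)
  then have "finite T" "T \<subseteq> V" using assms(2,3) finite_subset by (blast, blast)
  moreover have "graph_hom E T V f" using assms(4) TA unfolding graph_hom_def by blast
  ultimately obtain g where g: "graph_hom E V V g" "\<And>x. x \<in> T \<Longrightarrow> g x = f x"
    by (rule ME_homogeneousD[OF assms(1) _ _ _ T(2)]) (rule that)
  have "E (g a) (f x)" if x: "x \<in> A" "E a x" for x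
  proof -
    have "f x \<in> f ` T" using x T(3) by (auto simp: N_def)
    then obtain t where t: "t \<in> T" "f x = f t" by blast
    then have "E a t" "t \<in> V" using T(1) \<open>T \<subseteq> V\<close> by (auto simp: N_def)
    then have "E (g a) (g t)" using g(1) assms(5) by (simp add: graph_hom_def)
    then show ?thesis using g(2) t by simp
  qed
  moreover have "g a \<in> V" using g(1) assms(5) by (auto simp: graph_hom_def)
  ultimately show ?thesis by blast
qed

text \<open>As \<open>j\<close> preserves non-adjacency, its inverse \<open>k\<close> is a
  monomorphism of \<open>E\<close>. The required point is a preimage of \<open>b\<close> under a
  surjective extension \<open>g\<close> of \<open>k\<close>: an edge from it to \<open>j s\<close>
  would be mapped to an edge from \<open>b\<close> to \<open>s\<close>.\<close>

lemma ME_injective_extension: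
  assumes "graph V E" "ME_homogeneous V E"
  shows "injective_extension V (non_adjacent V E)"
proof
  fix x y
  show "x \<in> V" if "non_adjacent V E x y" using that by (simp add: non_adjacent_def)
  show "non_adjacent V E y x" if "non_adjacent V E x y"
    using that assms(1) by (auto simp: non_adjacent_def graph_def)
  show "\<not> non_adjacent V E x x" by (simp add: non_adjacent_def)
next
  fix S j b
  assume S: "finite S" "S \<subseteq> V" "inj_on j S" "j ` S \<subseteq> V"
    and mono: "\<And>s t. \<lbrakk>s \<in> S; t \<in> S; non_adjacent V E s t\<rbrakk> \<Longrightarrow> non_adjacent V E (j s) (j t)"
    and b: "b \<in> V - S"
  define k where "k = inv_into S j"
  have k: "k (j s) = s" if "s \<in> S" for s using that S(3) by (simp add: k_def)
  have "E (k u) (k v)" if uv: "u \<in> j ` S" "v \<in> j ` S" "E u v" for u v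
  proof (rule ccontr)
    assume no: "\<not> E (k u) (k v)"
    obtain s t where st: "s \<in> S" "u = j s" "t \<in> S" "v = j t" using uv by blast
    have "s \<noteq> t" using uv(3) st assms(1) by (auto simp: graph_def)
    with no st S(2) have "non_adjacent V E s t" by (auto simp: k non_adjacent_def)
    with mono st uv(3) show False by (auto simp: non_adjacent_def)
  qed
  moreover have "k ` j ` S \<subseteq> V" using k S(2) by auto
  ultimately have "graph_hom E (j ` S) V k" by (simp add: graph_hom_def)
  moreover have "inj_on k (j ` S)" using k by (auto simp: inj_on_def)
  ultimately obtain g where g: "graph_hom E V V g" "g ` V = V" "\<And>x. x \<in> j ` S \<Longrightarrow> g x = k x"
    by (rule ME_homogeneousD[OF assms(2) finite_imageI[OF S(1)] S(4)]) (rule that)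
  have "b \<in> g ` V" using g(2) b by simp
  then obtain a where a: "a \<in> V" "g a = b" by blast
  have gj: "g (j s) = s" if "s \<in> S" for s using that g(3) k by simp
  have "a \<notin> j ` S" using gj a(2) b by auto
  moreover have "non_adjacent V E a (j s)" if s: "s \<in> S" "non_adjacent V E b s" for s
  proof -
    have "\<not> E a (j s)"
    proof
      assume "E a (j s)"
      moreover have "j s \<in> V" using s(1) S(4) by blast
      ultimately have "E (g a) (g (j s))" using g(1) a(1) unfolding graph_hom_def by blast
      then show False using gj s a(2) by (simp add: non_adjacent_def)
    qed
    then show ?thesis using \<open>a \<notin> j ` S\<close> s S(4) a(1) by (auto simp: non_adjacent_def)
  qed
  ultimately show "\<exists>a\<in>V - j ` S. \<forall>s\<in>S. non_adjacent V E b s \<longrightarrow> non_adjacent V E a (j s)"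
    using a(1) by blast
qed

text \<open>Since \<open>Z\<close> has no cone, each point of \<open>K\<close> lies in
  \<open>Z\<close> or is \<open>E\<close>-adjacent to some \<open>z\<close> in \<open>Z\<close>. If
  \<open>z\<close> had more than \<open>card S\<close> neighbours in \<open>K\<close>, an
  \<open>E\<close>-independent set, \<open>card S\<close> of them could be mapped onto
  \<open>S\<close>, and the image of \<open>z\<close> would be an anticone of
  \<open>S\<close>.\<close>

lemma ME_complete_bound:
  assumes "graph V E" "ME_homogeneous V E"
    and Z: "finite Z" "Z \<subseteq> V" "\<And>c. c \<in> V \<Longrightarrow> \<exists>z\<in>Z. \<not> non_adjacent V E c z"
    and S: "finite S" "S \<subseteq> V" "\<And>v. v \<in> V - S \<Longrightarrow> \<exists>x\<in>S. non_adjacent V E v x"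
    and K: "finite K" "K \<subseteq> V" "\<And>x y. \<lbrakk>x \<in> K; y \<in> K; x \<noteq> y\<rbrakk> \<Longrightarrow> non_adjacent V E x y"
  shows "card K \<le> card Z + card Z * card S"
proof -
  have irrefl: "\<not> E x x" and sym: "E x y \<Longrightarrow> E y x" for x y
    using assms(1) by (auto simp: graph_def)
  define N where "N z = {k \<in> K. E z k}" for z
  have N: "card (N z) \<le> card S" if "z \<in> Z" for z
  proof (rule ccontr)
    assume "\<not> card (N z) \<le> card S"
    then obtain T where T: "T \<subseteq> N z" "card T = card S" "finite T"
      using obtain_subset_with_card_n[of "card S" "N z"] by auto
    obtain h where h: "bij_betw h T S" using finite_same_card_bij[OF T(3) S(1) T(2)] by blast
    have TK: "T \<subseteq> K" "\<And>t. t \<in> T \<Longrightarrow> E z t" using T(1) by (auto simp: N_def)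
    have "graph_hom E T V h"
      unfolding graph_hom_def
    proof (intro conjI ballI impI)
      show "h ` T \<subseteq> V" using h S(2) by (simp add: bij_betw_def)
      fix x y assume "x \<in> T" "y \<in> T" "E x y"
      then have False using irrefl K(3)[of x y] TK(1) by (auto simp: non_adjacent_def)
      then show "E (h x) (h y)" ..
    qed
    moreover have "T \<subseteq> V" "z \<in> V" using TK(1) K(2) Z(2) that by auto
    ultimately obtain c where c: "c \<in> V" "\<And>t. t \<in> T \<Longrightarrow> E c (h t)"
      using ME_forward[OF assms(2) T(3), of h z] TK(2) by blast
    have cS: "E c s" if "s \<in> S" for s using that c(2) h by (auto simp: bij_betw_def)
    then have "c \<in> V - S" using irrefl c(1) by blast
    from S(3)[OF this] show False using cS by (auto simp: non_adjacent_def)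
  qed
  have "K \<subseteq> Z \<union> (\<Union>z\<in>Z. N z)"
  proof
    fix x assume x: "x \<in> K"
    then obtain z where z: "z \<in> Z" "\<not> non_adjacent V E x z" using Z(3) K(2) by blast
    then have "x = z \<or> E z x" using x K(2) Z(2) sym[of x z] by (auto simp: non_adjacent_def)
    then show "x \<in> Z \<union> (\<Union>z\<in>Z. N z)" using x z(1) by (auto simp: N_def)
  qed
  moreover have "finite (Z \<union> (\<Union>z\<in>Z. N z))" using Z(1) K(1) by (auto simp: N_def)
  ultimately have "card K \<le> card (Z \<union> (\<Union>z\<in>Z. N z))" by (rule card_mono[rotated])
  also have "\<dots> \<le> card Z + card (\<Union>z\<in>Z. N z)" by (rule card_Un_le)
  also have "card (\<Union>z\<in>Z. N z) \<le> (\<Sum>z\<in>Z. card (N z))" by (rule card_UN_le[OF Z(1)])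
  also have "(\<Sum>z\<in>Z. card (N z)) \<le> card Z * card S" using sum_bounded_above[of Z "\<lambda>z. card (N z)", OF N] by simp
  finally show ?thesis by simp
qed

lemma ME_backward:
  assumes G: "graph V E" and "infinite V" and ME: "ME_homogeneous V E"
    and A: "finite A" "A \<subseteq> V" and f: "graph_hom E A V f" and b: "b \<in> V - f ` A"
  shows "\<exists>a\<in>V - A. \<forall>x\<in>A. E a x \<longrightarrow> E b (f x)"
proof -
  let ?R = "non_adjacent V E"
  interpret injective_extension V ?R by (rule ME_injective_extension[OF G ME])
  \<comment> \<open>These are the points to which \<open>a\<close> must not be
    \<open>E\<close>-adjacent, so an \<open>?R\<close>-cone of \<open>X\<close> outside
    \<open>A\<close> suffices.\<close>
  define X where "X = {x \<in> A. ?R b (f x)}"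
  have fV: "f x \<in> V" if "x \<in> A" for x using f that by (auto simp: graph_hom_def)
  have XA: "X \<subseteq> A" by (auto simp: X_def)
  have "\<exists>a. cone a X \<and> a \<notin> A"
  proof (cases "X = {}")
    case True
    obtain a where "a \<in> V - A" using \<open>infinite V\<close> A(1) by (metis finite_Diff2 finite.emptyI all_not_in_conv)
    then show ?thesis using True by (auto simp: cone_def)
  next
    case False
    then obtain x where x: "x \<in> A" "?R b (f x)" by (auto simp: X_def)
    consider (cones) "\<And>F. \<lbrakk>finite F; F \<subseteq> V\<rbrakk> \<Longrightarrow> \<exists>c. cone c F"
      | (anticones) "\<And>F. \<lbrakk>finite F; F \<subseteq> V\<rbrakk> \<Longrightarrow> \<exists>v\<in>V - F. \<forall>x\<in>F. \<not> ?R v x"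
      | (neither) Z S where "finite Z" "Z \<subseteq> V" "\<not> (\<exists>c. cone c Z)"
        "finite S" "S \<subseteq> V" "\<not> (\<exists>v\<in>V - S. \<forall>x\<in>S. \<not> ?R v x)"
      by metis
    then show ?thesis
    proof cases
      case cones
      then obtain a where a: "cone a A" using A by blast
      then have "a \<notin> A" using R_irrefl by (auto simp: cone_def)
      then show ?thesis using a XA by (auto simp: cone_def)
    next
      case anticones
      then interpret anticone_extension V ?R by unfold_locales
      show ?thesis
      proof (cases "\<exists>I c. finite I \<and> stable I \<and> card I = 2 \<and> cone c I")
        case True
        then show ?thesis using finite_cone XA A by blast
      next
        case False
        have trans: "?R p q" if "?R c p" "?R c q" "p \<noteq> q" for c p q
        proof (rule ccontr)
          assume "\<not> ?R p q"
          then have "stable {p, q}" "cone c {p, q}"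
            using that R_in R_sym R_irrefl by (auto simp: stable_def cone_def)
          then show False using False that(3) by (metis card_2_iff finite.emptyI finite.insertI)
        qed
        \<comment> \<open>The edge between \<open>b\<close> and \<open>f x\<close> is a star with
          one leaf; moving the leaf to \<open>x\<close> gives \<open>x\<close> an
          \<open>?R\<close>-neighbour outside \<open>A\<close>.\<close>
        have "stable {f x}" "cone b {f x}"
          using x fV R_irrefl b by (auto simp: stable_def cone_def)
        then obtain a where a: "cone a {x}" "a \<notin> A"
          using cone_avoiding[of "{f x}" b "{x}" A] x(1) A by auto
        then have ax: "?R x a" using R_sym by (auto simp: cone_def)
        \<comment> \<open>\<open>f x\<close> and \<open>f y\<close> have the common neighbour
          \<open>b\<close>, so they are equal or \<open>?R\<close>-adjacent. As \<open>f\<close> is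
          a homomorphism, \<open>x\<close> and \<open>y\<close> are not \<open>E\<close>-adjacent,
          and \<open>trans\<close> at \<open>x\<close> yields the claim.\<close>
        have "?R a y" if y: "y \<in> X" for y
        proof (cases "y = x")
          case False
          have "\<not> E (f x) (f y)"
          proof (cases "f x = f y")
            case True
            then show ?thesis using G by (simp add: graph_def)
          next
            case False
            with trans[OF x(2), of "f y"] y show ?thesis by (simp add: X_def non_adjacent_def)
          qed
          then have "\<not> E x y" using f x(1) y by (auto simp: X_def graph_hom_def)
          then have "?R x y" using False x(1) y A(2) by (auto simp: X_def non_adjacent_def)
          then show ?thesis using trans[OF ax] y a(2) XA by blast
        qed (use ax R_sym in blast)
        then show ?thesis using a by (auto simp: cone_def)
      qed
    next
      case (neither Z S)
      have "card K \<le> card Z + card Z * card S" if "finite K" "complete K" for K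
        using ME_complete_bound[OF G ME, of Z S K] neither that
        by (auto simp: cone_def complete_def)
      then have False using complete_bound_le_1 \<open>infinite V\<close> x(2) by blast
      then show ?thesis ..
    qed
  qed
  then obtain a where a: "a \<in> V" "\<And>x. x \<in> X \<Longrightarrow> ?R a x" "a \<notin> A" by (auto simp: cone_def)
  have "E b (f x)" if "x \<in> A" "E a x" for x
    using that a(2)[of x] fV[of x] b by (auto simp: X_def non_adjacent_def)
  then show ?thesis using a by blast
qed

section \<open>Back-and-forth construction of a surjective endomorphism\<close>

lemma back_and_forth_step:
  assumes G: "graph V E" and "infinite V" and ME: "ME_homogeneous V E"
    and A: "finite A" "A \<subseteq> V" and f: "graph_hom E A V f" and v: "v \<in> V"
  shows "\<exists>A' f'. finite A' \<and> A' \<subseteq> V \<and> graph_hom E A' V f' \<and> A \<subseteq> A' \<and> (\<forall>x\<in>A. f' x = f x) \<and>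
    v \<in> A' \<and> v \<in> f' ` A'"
proof -
  have irrefl: "\<not> E x x" and sym: "E x y \<Longrightarrow> E y x" for x y
    using G by (auto simp: graph_def)
  have upd: "graph_hom E (insert a B) V (h(a := c))"
    if "graph_hom E B V h" "a \<notin> B" "c \<in> V" "\<forall>x\<in>B. E a x \<longrightarrow> E c (h x)" for a B h c
    unfolding graph_hom_def
  proof (intro conjI ballI impI)
    show "(h(a := c)) ` insert a B \<subseteq> V" using that(1-3) by (auto simp: graph_hom_def)
    fix x y assume "x \<in> insert a B" "y \<in> insert a B" "E x y"
    then consider "x = a" "y \<in> B" | "y = a" "x \<in> B" | "x \<in> B" "y \<in> B" using irrefl by blast
    then show "E ((h(a := c)) x) ((h(a := c)) y)"
    proof cases
      case 1
      then have "y \<noteq> a" "E c (h y)" using that(2,4) \<open>E x y\<close> by auto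
      then show ?thesis using 1 by simp
    next
      case 2
      then have "x \<noteq> a" "E c (h x)" using that(2,4) sym[OF \<open>E x y\<close>] by auto
      then show ?thesis using 2 sym by simp
    next
      case 3
      then have "x \<noteq> a" "y \<noteq> a" using that(2) by auto
      then show ?thesis using 3 that(1) \<open>E x y\<close> by (simp add: graph_hom_def)
    qed
  qed
  \<comment> \<open>First \<open>v\<close> is put into the domain by \<open>ME_forward\<close>;
    afterwards \<open>ME_backward\<close> puts it into the image.\<close>
  obtain B h where B: "finite B" "B \<subseteq> V" "graph_hom E B V h" "A \<subseteq> B" "\<forall>x\<in>A. h x = f x" "v \<in> B"
  proof (cases "v \<in> A")
    case True
    then show ?thesis using that[of A f] A f by blast
  next
    case False
    obtain c where "c \<in> V" "\<forall>x\<in>A. E v x \<longrightarrow> E c (f x)"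
      using ME_forward[OF ME A f v] by blast
    from upd[OF f False this] show ?thesis
      using A v False by (intro that[of "insert v A" "f(v := c)"]) auto
  qed
  show ?thesis
  proof (cases "v \<in> h ` B")
    case True
    then show ?thesis using B by blast
  next
    case False
    obtain a where a: "a \<in> V" "a \<notin> B" "\<forall>x\<in>B. E a x \<longrightarrow> E v (h x)"
      using ME_backward[OF G \<open>infinite V\<close> ME B(1-3), of v] False v by blast
    from upd[OF B(3) a(2) v a(3)] show ?thesis
      using B(1,2,4,5,6) a(1,2) by (intro exI[of _ "insert a B"] exI[of _ "h(a := v)"]) auto
  qed
qed

lemma ME_imp_HE:
  assumes G: "graph V E" and "countable V" and "infinite V" and ME: "ME_homogeneous V E"
  shows "HE_homogeneous V E"
  unfolding HE_homogeneous_def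
proof (intro allI impI)
  fix A B f
  assume *: "A \<subseteq> V \<and> B \<subseteq> V \<and> finite A \<and> finite B \<and> graph_hom E A B f"
  define good where "good p \<longleftrightarrow> finite (fst p) \<and> fst p \<subseteq> V \<and> graph_hom E (fst p) V (snd p)"
    for p :: "'a set \<times> ('a \<Rightarrow> 'a)"
  \<comment> \<open>The clause for \<open>n = 0\<close> anchors the chain at \<open>f\<close>; step
    \<open>n\<close> handles the \<open>n\<close>-th vertex of an enumeration of
    \<open>V\<close>.\<close>
  have "\<exists>F. \<forall>n::nat. (good (F n) \<and> (n = 0 \<longrightarrow> F n = (A, f))) \<and>
      (fst (F n) \<subseteq> fst (F (Suc n)) \<and> (\<forall>x\<in>fst (F n). snd (F (Suc n)) x = snd (F n) x) \<and>
       from_nat_into V n \<in> fst (F (Suc n)) \<and> from_nat_into V n \<in> snd (F (Suc n)) ` fst (F (Suc n)))"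
  proof (rule dependent_nat_choice)
    show "\<exists>p. good p \<and> (0 = 0 \<longrightarrow> p = (A, f))"
      using * by (auto simp: good_def graph_hom_def)
    fix p and n :: nat
    assume "good p \<and> (n = 0 \<longrightarrow> p = (A, f))"
    moreover have "from_nat_into V n \<in> V" using \<open>infinite V\<close> by (auto intro: from_nat_into)
    ultimately obtain A' f' where "finite A'" "A' \<subseteq> V" "graph_hom E A' V f'" "fst p \<subseteq> A'"
      "\<forall>x\<in>fst p. f' x = snd p x" "from_nat_into V n \<in> A'" "from_nat_into V n \<in> f' ` A'"
      using back_and_forth_step[OF G \<open>infinite V\<close> ME, of "fst p" "snd p" "from_nat_into V n"]
      unfolding good_def by metis
    then show "\<exists>q. (good q \<and> (Suc n = 0 \<longrightarrow> q = (A, f))) \<and>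
      (fst p \<subseteq> fst q \<and> (\<forall>x\<in>fst p. snd q x = snd p x) \<and>
       from_nat_into V n \<in> fst q \<and> from_nat_into V n \<in> snd q ` fst q)"
      by (intro exI[of _ "(A', f')"]) (simp add: good_def)
  qed
  then obtain F where F: "\<And>n. good (F n)" "F 0 = (A, f)"
    "\<And>n. fst (F n) \<subseteq> fst (F (Suc n))"
    "\<And>n x. x \<in> fst (F n) \<Longrightarrow> snd (F (Suc n)) x = snd (F n) x"
    "\<And>n. from_nat_into V n \<in> fst (F (Suc n))"
    "\<And>n. from_nat_into V n \<in> snd (F (Suc n)) ` fst (F (Suc n))"
    by metis
  have mono: "fst (F m) \<subseteq> fst (F n)" if "m \<le> n" for m n
    using lift_Suc_mono_le[of "\<lambda>n. fst (F n)", OF F(3) that] .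
  have agree: "snd (F n) x = snd (F m) x" if "m \<le> n" "x \<in> fst (F m)" for m n x
    using that(1)
  proof (induction n rule: dec_induct)
    case (step n)
    then show ?case using F(4)[of x n] mono[of m n] that(2) by auto
  qed simp
  \<comment> \<open>The union of the chain; by \<open>agree\<close>, any stage containing
    \<open>x\<close> gives the same value.\<close>
  define g where "g x = snd (F (LEAST n. x \<in> fst (F n))) x" for x
  have g: "g x = snd (F n) x" if "x \<in> fst (F n)" for x n
    unfolding g_def
    using agree[OF Least_le[where P = "\<lambda>n. x \<in> fst (F n)", OF that]
        LeastI[where P = "\<lambda>n. x \<in> fst (F n)", OF that]] by simp
  have enum: "\<exists>n. x = from_nat_into V n" if "x \<in> V" for x
    using range_from_nat_into[of V] that assms(2) by (metis empty_iff imageE)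
  have dom: "\<exists>n. x \<in> fst (F n)" if "x \<in> V" for x
    using enum[OF that] F(5) by blast
  have "g x \<in> V" if "x \<in> V" for x
  proof -
    obtain n where n: "x \<in> fst (F n)" using dom[OF \<open>x \<in> V\<close>] by blast
    then show ?thesis using g[OF n] F(1)[of n] by (auto simp: good_def graph_hom_def)
  qed
  moreover have "E (g x) (g y)" if xy: "x \<in> V" "y \<in> V" "E x y" for x y
  proof -
    obtain m n where "x \<in> fst (F m)" "y \<in> fst (F n)" using dom xy by blast
    then have "x \<in> fst (F (max m n))" "y \<in> fst (F (max m n))"
      using mono[of m "max m n"] mono[of n "max m n"] by auto
    then show ?thesis using g F(1)[of "max m n"] xy(3) by (auto simp: good_def graph_hom_def)
  qed
  moreover have "v \<in> g ` V" if "v \<in> V" for v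
  proof -
    obtain n where n: "v = from_nat_into V n" using enum[OF \<open>v \<in> V\<close>] by blast
    obtain x where x: "x \<in> fst (F (Suc n))" "v = snd (F (Suc n)) x" using F(6)[of n] n by blast
    then have "x \<in> V" "v = g x" using F(1)[of "Suc n"] g by (auto simp: good_def)
    then show ?thesis by blast
  qed
  moreover have "g x = f x" if "x \<in> A" for x
    using g[of x 0] F(2) that by simp
  ultimately show "extends_to_surj_endo V E A f"
    unfolding extends_to_surj_endo_def graph_hom_def by (intro exI[of _ g]) blast
qed

theorem theorem7p3:
  fixes V :: "'a set" and E :: "'a \<Rightarrow> 'a \<Rightarrow> bool"
  assumes "graph V E" and "countable V" and "infinite V"
  shows "ME_homogeneous V E \<longleftrightarrow> HE_homogeneous V E"
proof
  show "HE_homogeneous V E" if "ME_homogeneous V E" using ME_imp_HE[OF assms that] .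
  show "ME_homogeneous V E" if "HE_homogeneous V E"
    using that unfolding ME_homogeneous_def HE_homogeneous_def graph_mono_def by blast
qed

end
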